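(* Let $r\ge 1$, $a,w_1,\dots,w_r>0$, $\bm{w}=(w_1,\dots,w_r)$, and let $N\ge -r$ be an integer. If $B^{(r)}_{r+N+1}(a,\bm{w})\,B^{(r)}_{r+N}(a,\bm{w})>0$, then $\zeta_r(\sigma,\bm{w},a)$ has a real zero $\sigma$ in the interval $(-N-1,-N)$.
   Context: The Barnes $r$-ple zeta function is $\zeta_r(s,\bm{w},a)=\sum_{m_1=0}^\infty\cdots\sum_{m_r=0}^\infty (a+m_1w_1+\cdots+m_rw_r)^{-s}$ for $\Re(s)>r$, meromorphically continued to $\mathbb{C}$ with simple poles at $s=1,\dots,r$. The generalized $r$-ple Bernoulli polynomials $B^{(r)}_k(x,\bm{w})$ ($k\ge 0$) are defined by $\frac{t^re^{(w_1+\cdots+w_r-x)t}}{(e^{w_1t}-1)\cdots(e^{w_rt}-1)}=\sum_{k=0}^\infty B_k^{(r)}(x,\bm{w})\frac{t^k}{k!}$ for $|t|<\min\{2\pi/w_1,\dots,2\pi/w_r\}$. *)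

theory Defs
  imports "HOL-Complex_Analysis.Complex_Analysis"
begin

(* The weights are w 1, ..., w r; values of w outside {1..r} are irrelevant.  The multiple
   series is an unordered sum over all r-tuples m of natural numbers; for a, w i > 0 it
   converges absolutely when Re s > r. *)
definition barnes_series :: "nat \<Rightarrow> (nat \<Rightarrow> real) \<Rightarrow> real \<Rightarrow> complex \<Rightarrow> complex" where
  "barnes_series r w a s =
     (\<Sum>\<^sub>\<infinity>m\<in>({1..r} \<rightarrow>\<^sub>E (UNIV :: nat set)).
        of_real (a + (\<Sum>i=1..r. real (m i) * w i)) powr (-s))"

(* The meromorphic continuation to the whole plane.  "Nicely" meromorphic means that there
   are no removable singularities and that the value at a pole is 0, so the
   continuation is unique as a total function. *)
definition barnes_zeta :: "nat \<Rightarrow> (nat \<Rightarrow> real) \<Rightarrow> real \<Rightarrow> complex \<Rightarrow> complex" where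
  "barnes_zeta r w a =
     (THE f. f nicely_meromorphic_on UNIV \<and>
             (\<forall>s. Re s > real r \<longrightarrow> f s = barnes_series r w a s))"

(* barnes_bernoulli r k x w is the value B_k^(r)(x, w).  The point t = 0 is a removable
   singularity of the generating function (where HOL division would give 0), hence the
   condition t \<noteq> 0; it does not affect the uniqueness of the coefficients. *)
definition barnes_bernoulli :: "nat \<Rightarrow> nat \<Rightarrow> real \<Rightarrow> (nat \<Rightarrow> real) \<Rightarrow> real" where
  "barnes_bernoulli r k x w =
     (THE B :: nat \<Rightarrow> real. \<forall>t::complex.
        t \<noteq> 0 \<and> norm t < Min ((\<lambda>i. 2 * pi / w i) ` {1..r}) \<longrightarrow>
        (\<lambda>n. of_real (B n) * t ^ n / fact n) sums
          (t ^ r * exp (of_real ((\<Sum>i=1..r. w i) - x) * t) /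
             (\<Prod>i=1..r. (exp (of_real (w i) * t) - 1)))) k"

end

theory Submission
  imports Defs
begin

text \<open>
  Let $F(t) = e^{-at} / \prod_i (1 - e^{-w_i t})$, so that $\Gamma(s)\zeta_r(s) = \int_0^\infty t^{s-1} F(t)\,dt$
  for $\Re s > r$, and $t^r F(t) = \sum_n b_n t^n$ near $0$ with $b_n = B^{(r)}_n(a) / n!$.  Splitting the integral
  at a point $c$ inside the disc of convergence and integrating the power series term by term gives
  $\int_c^\infty t^{s-1} F(t)\,dt + c^{s-r} \sum_n b_n c^n / (s+n-r)$, which is meromorphic on the whole plane,
  so it continues $\Gamma(s)\zeta_r(s)$, with residue $b_n$ at $r - n$.  If $b_k$ and $b_{k+1}$, where $k = r + N$,
  have the same sign, this function has opposite infinite limits at the two ends of $(r-k-1, r-k) = (-N-1,-N)$,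
  so it vanishes in between, and hence so does $\zeta_r$.  The argument does not distinguish the values of
  $\zeta_r$ at nonpositive integers from its residues at $1,\dots,r$.
\<close>

subsection \<open>Integrals and meromorphic functions\<close>

text \<open>Euler's integral after the substitution \<open>t -> l * t\<close>; a power of a product
  of positive reals factors, so the scale contributes \<open>l powr (- z)\<close>. The integrals of
  the single terms of the Barnes series have this form.\<close>

lemma set_integral_powr_exp:
  fixes l :: real and z :: complex
  assumes l: "l > 0" and z: "Re z > 0"
  shows set_integrable_powr_exp:
      "set_integrable lborel {0<..} (\<lambda>t. of_real t powr (z - 1) * of_real (exp (- l * t)))"
    and set_integral_powr_exp_eq:
      "(LINT t:{0<..}|lborel. of_real t powr (z - 1) * of_real (exp (- l * t)))
         = Gamma z * of_real l powr (- z)"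
proof -
  let ?g = "\<lambda>k t. indicator {0<..} t *\<^sub>R (complex_of_real t powr (z - 1) * of_real (exp (- k * t)))"
  have int: "integrable lborel (?g k)" if "k > 0" for k :: real
  proof -
    have "(\<lambda>t. complex_of_real t powr (z - 1) / of_real (exp (k * t))) absolutely_integrable_on {0<..}"
      by (rule absolutely_integrable_Gamma_integral) (use z that in auto)
    hence "integrable lebesgue (?g k)"
      by (simp add: set_integrable_def exp_minus field_simps)
    thus ?thesis
      by (subst (asm) integrable_completion) auto
  qed
  show "set_integrable lborel {0<..} (\<lambda>t. of_real t powr (z - 1) * of_real (exp (- l * t)))"
    using int[OF l] by (simp add: set_integrable_def)
  have "set_integrable lborel {0<..} (\<lambda>t. of_real t powr (z - 1) * of_real (exp (- 1 * t)))"
    using int[of 1] by (simp add: set_integrable_def)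
  from set_borel_integral_eq_integral(2)[OF this]
  have "Gamma z = (LINT t:{0<..}|lborel. of_real t powr (z - 1) * of_real (exp (- 1 * t)))"
    using Gamma_integral_complex'[OF z] by (simp add: exp_minus field_simps integral_unique)
  also have "\<dots> = integral\<^sup>L lborel (?g 1)"
    by (simp add: set_lebesgue_integral_def)
  also have "\<dots> = l *\<^sub>R (LINT t|lborel. ?g 1 (l * t))"
    using lborel_integral_real_affine[of l "?g 1" 0] l by simp
  also have "(\<lambda>t. ?g 1 (l * t)) = (\<lambda>t. of_real l powr (z - 1) * ?g l t)"
  proof
    fix t :: real
    have "complex_of_real (l * t) powr (z - 1) = of_real l powr (z - 1) * of_real t powr (z - 1)" if "t > 0"
      using that l by (subst powr_times_real[symmetric]) auto
    thus "?g 1 (l * t) = of_real l powr (z - 1) * ?g l t"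
      using l by (auto simp: indicator_def zero_less_mult_iff)
  qed
  also have "l *\<^sub>R (LINT t|lborel. of_real l powr (z - 1) * ?g l t) =
      (of_real l * of_real l powr (z - 1)) * (LINT t|lborel. ?g l t)"
    by (simp add: scaleR_conv_of_real)
  also have "of_real l * of_real l powr (z - 1) = complex_of_real l powr z"
    using l by (simp add: powr_diff)
  finally show "(LINT t:{0<..}|lborel. of_real t powr (z - 1) * of_real (exp (- l * t)))
         = Gamma z * of_real l powr (- z)"
    using l by (simp add: set_lebesgue_integral_def powr_minus field_simps)
qed

lemma set_integrable_powr_exp_real:
  fixes l x :: real
  assumes l: "l > 0" and x: "x > 0"
  shows "set_integrable lborel {0<..} (\<lambda>t. t powr (x - 1) * exp (- l * t))"
proof -
  have "set_integrable lborel {0<..} (\<lambda>t. norm (complex_of_real t powr (of_real x - 1) * of_real (exp (- l * t))))"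
    using set_integrable_norm[OF set_integrable_powr_exp[OF l, of "of_real x"]] x by simp
  also have "?this \<longleftrightarrow> ?thesis"
    by (rule set_integrable_cong) (auto simp: norm_mult norm_powr_real_powr)
  finally show ?thesis .
qed

text \<open>Since \<open>1 + 1/t\<close> is at most twice the larger of \<open>1\<close> and
  \<open>1/t\<close>. The right-hand side is a sum of powers of \<open>t\<close>, ready for
  integration against an exponential.\<close>

lemma one_add_inverse_power_le:
  fixes t :: real
  assumes "t > 0"
  shows "(1 + 1 / t) ^ n \<le> 2 ^ n * (1 + t powr (- real n))"
proof -
  have "(1 + 1 / t) ^ n \<le> (2 * max 1 (1 / t)) ^ n"
    using assms by (intro power_mono) auto
  also have "\<dots> = 2 ^ n * max 1 (1 / t) ^ n"
    by (simp add: power_mult_distrib)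
  also have "max 1 (1 / t) ^ n \<le> 1 + (1 / t) ^ n"
    using assms by (auto simp: max_def)
  also have "(1 / t) ^ n = t powr (- real n)"
    using assms by (simp add: powr_minus powr_realpow power_inverse divide_inverse)
  finally show ?thesis by simp
qed

text \<open>Follows from \<open>exp (u * t) >= 1 + u * t\<close>. The bound shows the simple pole at
  \<open>0\<close> and boundedness at infinity, with the dependence on \<open>u\<close> separated
  off.\<close>

lemma inverse_one_minus_exp_le:
  fixes u t :: real
  assumes "u > 0" "t > 0"
  shows "1 / (1 - exp (- u * t)) \<le> (1 + 1 / u) * (1 + 1 / t)"
proof -
  have "exp (- u * t) \<le> 1 / (1 + u * t)"
    using exp_ge_add_one_self[of "u * t"] assms
    by (simp add: exp_minus field_simps add_pos_pos)
  moreover have "u * t / (1 + u * t) = 1 - 1 / (1 + u * t)"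
    using mult_pos_pos[OF assms] by (simp add: field_simps)
  ultimately have "1 - exp (- u * t) \<ge> u * t / (1 + u * t)"
    by simp
  hence "1 / (1 - exp (- u * t)) \<le> 1 / (u * t / (1 + u * t))"
    using assms by (intro divide_left_mono) (auto intro!: mult_pos_pos divide_pos_pos add_pos_pos)
  also have "\<dots> \<le> (1 + 1 / u) * (1 + 1 / t)"
    using assms by (simp add: field_simps)
  finally show ?thesis .
qed

lemma set_integrable_powr_0:
  fixes x c :: real
  assumes x: "x > 0" and c: "c > 0"
  shows "set_integrable lborel {0<..<c} (\<lambda>t. t powr (x - 1))"
    and "(LINT t:{0<..<c}|lborel. t powr (x - 1)) = c powr x / x"
proof -
  have hi: "((\<lambda>t. t powr (x - 1)) has_integral (c powr x / x)) {0..c}"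
    using has_integral_powr_from_0[of "x - 1" c] x c by simp
  hence hi': "((\<lambda>t. t powr (x - 1)) has_integral (c powr x / x)) {0<..<c}"
    by (simp add: has_integral_Icc_iff_Ioo)
  hence "(\<lambda>t. t powr (x - 1)) absolutely_integrable_on {0<..<c}"
    by (subst absolutely_integrable_on_iff_nonneg) (auto simp: integrable_on_def)
  hence "integrable lebesgue (\<lambda>t. indicator {0<..<c} t *\<^sub>R t powr (x - 1))"
    by (simp add: set_integrable_def)
  hence *: "integrable lborel (\<lambda>t. indicator {0<..<c} t *\<^sub>R t powr (x - 1))"
    by (subst (asm) integrable_completion) auto
  thus **: "set_integrable lborel {0<..<c} (\<lambda>t. t powr (x - 1))"
    by (simp add: set_integrable_def)
  show "(LINT t:{0<..<c}|lborel. t powr (x - 1)) = c powr x / x"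
    using set_borel_integral_eq_integral(2)[OF **] hi' by (simp add: integral_unique)
qed

text \<open>The antiderivative \<open>t powr z / z\<close> extends continuously to \<open>0\<close>
  because \<open>Re z > 0\<close>, so the fundamental theorem applies with differentiability in the
  open interval only.\<close>

lemma set_integral_cpowr_0:
  fixes c :: real and z :: complex
  assumes z: "Re z > 0" and c: "c > 0"
  shows "set_integrable lborel {0<..<c} (\<lambda>t. complex_of_real t powr (z - 1))"
    and "(LINT t:{0<..<c}|lborel. complex_of_real t powr (z - 1)) = of_real c powr z / z"
proof -
  show *: "set_integrable lborel {0<..<c} (\<lambda>t. complex_of_real t powr (z - 1))"
    by (rule set_integrable_bound[OF set_integrable_powr_0(1)[OF z c]])
       (auto simp: set_borel_measurable_def norm_powr_real_powr)
  have z0: "z \<noteq> 0" using z by auto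
  have "((\<lambda>t. complex_of_real t powr (z - 1)) has_integral
           (of_real c powr z / z - of_real 0 powr z / z)) {0..c}"
  proof (rule fundamental_theorem_of_calculus_interior)
    show "continuous_on {0..c} (\<lambda>t. complex_of_real t powr z / z)"
    proof (intro continuous_on_divide continuous_on_const)
      show "continuous_on {0..c} (\<lambda>t. complex_of_real t powr z)"
        unfolding continuous_on_eq_continuous_within
      proof
        fix t assume t: "t \<in> {0..c}"
        show "continuous (at t within {0..c}) (\<lambda>t. complex_of_real t powr z)"
        proof (cases "t = 0")
          case False
          hence "of_real t \<notin> (\<real>\<^sub>\<le>\<^sub>0 :: complex set)"
            using t by (simp add: complex_nonpos_Reals_iff)
          hence "isCont (\<lambda>u. u powr z) (complex_of_real t)"
            by (rule DERIV_isCont[OF has_field_derivative_powr])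
          moreover have "isCont complex_of_real t"
            by (intro continuous_intros)
          ultimately have "isCont (\<lambda>t. complex_of_real t powr z) t"
            by (rule isCont_o2[rotated])
          thus ?thesis by (rule continuous_at_imp_continuous_within)
        next
          case True
          \<comment> \<open>The modulus of \<open>t powr z\<close> is \<open>t powr Re z\<close>,
            which tends to \<open>0\<close>; this matches the HOL value
            \<open>0 powr z = 0\<close>.\<close>
          have "((\<lambda>t. t powr Re z) \<longlongrightarrow> 0 powr Re z) (at 0 within {0..c})"
            by (rule tendsto_powr2[OF tendsto_ident_at tendsto_const])
               (use z in \<open>auto simp: eventually_at_filter\<close>)
          hence "((\<lambda>t. t powr Re z) \<longlongrightarrow> 0) (at 0 within {0..c})"
            by simp
          hence "((\<lambda>t. norm (complex_of_real t powr z)) \<longlongrightarrow> 0) (at 0 within {0..c})"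
            by (rule Lim_transform_eventually)
               (use z in \<open>auto simp: eventually_at_filter norm_powr_real_powr\<close>)
          thus ?thesis using z0 True by (simp add: continuous_within tendsto_norm_zero_iff)
        qed
      qed
    qed (use z0 in auto)
    show "((\<lambda>t. complex_of_real t powr z / z) has_vector_derivative complex_of_real t powr (z - 1)) (at t)"
      if "t \<in> {0<..<c}" for t
    proof -
      have "((\<lambda>u. u powr z / z) has_field_derivative of_real t powr (z - 1)) (at (of_real t))"
        using DERIV_cdivide[OF has_field_derivative_powr[of "of_real t" z], of z] that z0
        by (simp add: complex_nonpos_Reals_iff)
      from has_vector_derivative_real_field[OF this] show ?thesis by simp
    qed
  qed (use c in auto)
  hence "((\<lambda>t. complex_of_real t powr (z - 1)) has_integral (of_real c powr z / z)) {0<..<c}"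
    using z0 by (simp add: has_integral_Icc_iff_Ioo)
  thus "(LINT t:{0<..<c}|lborel. complex_of_real t powr (z - 1)) = of_real c powr z / z"
    using set_borel_integral_eq_integral(2)[OF *] by (simp add: integral_unique)
qed

section \<open>Series of simple poles, and uniqueness of coefficients and of continuations\<close>

text \<open>The poles \<open>p - n\<close> all lie on or to the left of the line
  \<open>Re s = Re p\<close>, so the Weierstrass test gives locally uniform convergence to its
  right.\<close>

lemma holomorphic_on_suminf_poles:
  fixes d :: "nat \<Rightarrow> complex" and p :: complex
  assumes d: "summable (\<lambda>n. norm (d n))"
  shows "(\<lambda>s. \<Sum>n. d n / (s + of_nat n - p)) holomorphic_on {s. Re s > Re p}"
proof (rule holomorphic_uniform_sequence[where f = "\<lambda>N s. \<Sum>n<N. d n / (s + of_nat n - p)"])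
  show "open {s. Re s > Re p}"
    by (rule open_halfspace_Re_gt)
  show "(\<lambda>s. \<Sum>n<N. d n / (s + of_nat n - p)) holomorphic_on {s. Re s > Re p}" for N
  proof (intro holomorphic_intros)
    fix n :: nat and s assume "s \<in> {s. Re s > Re p}"
    hence "Re (s + of_nat n - p) > 0" by simp
    thus "s + of_nat n - p \<noteq> 0" by force
  qed
  fix x assume "x \<in> {s. Re s > Re p}"
  \<comment> \<open>Half the distance from \<open>x\<close> to the boundary line: on the disc of
    this radius every denominator has real part at least \<open>e\<close>.\<close>
  define e where "e = (Re x - Re p) / 2"
  have e: "e > 0" using \<open>x \<in> _\<close> by (simp add: e_def)
  have far: "Re (s - p) \<ge> e" if "s \<in> cball x e" for s
    using that abs_Re_le_cmod[of "x - s"] by (simp add: dist_norm e_def field_simps abs_if split: if_splits)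
  have "uniform_limit (cball x e) (\<lambda>N s. \<Sum>n<N. d n / (s + of_nat n - p))
          (\<lambda>s. \<Sum>n. d n / (s + of_nat n - p)) sequentially"
  proof (rule Weierstrass_m_test)
    fix n s assume s: "s \<in> cball x e"
    have "e \<le> Re (s + of_nat n - p)"
      using far[OF s] by simp
    also have "\<dots> \<le> norm (s + of_nat n - p)"
      by (rule complex_Re_le_cmod)
    finally show "norm (d n / (s + of_nat n - p)) \<le> norm (d n) / e"
      using e by (auto simp: norm_divide intro!: divide_left_mono mult_pos_pos)
  qed (use d in auto)
  moreover have "cball x e \<subseteq> {s. Re s > Re p}"
    using far e by force
  ultimately show "\<exists>e>0. cball x e \<subseteq> {s. Re s > Re p} \<and>
      uniform_limit (cball x e) (\<lambda>N s. \<Sum>n<N. d n / (s + of_nat n - p))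
          (\<lambda>s. \<Sum>n. d n / (s + of_nat n - p)) sequentially"
    using e by blast
qed

text \<open>Nothing is assumed about \<open>f 0\<close>, since the Bernoulli generating function is
  a quotient \<open>0/0\<close> there. Both the reality and the uniqueness of the Bernoulli
  coefficients rest on this.\<close>

lemma powser_punctured_unique:
  fixes b d :: "nat \<Rightarrow> complex"
  assumes R: "R > 0"
    and b: "\<And>z. z \<noteq> 0 \<Longrightarrow> norm z < R \<Longrightarrow> (\<lambda>n. b n * z ^ n) sums f z"
    and d: "\<And>z. z \<noteq> 0 \<Longrightarrow> norm z < R \<Longrightarrow> (\<lambda>n. d n * z ^ n) sums f z"
  shows "b = d"
proof (rule ccontr)
  assume "b \<noteq> d"
  then obtain m where m: "b m \<noteq> d m" by auto
  \<comment> \<open>Shifting the coefficients by one makes the value at \<open>0\<close> irrelevant.\<close>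
  define e where "e = (\<lambda>n. case n of 0 \<Rightarrow> 0 | Suc k \<Rightarrow> b k - d k)"
  have e: "(\<lambda>n. e n * (z - 0) ^ n) sums 0" if "norm (z - 0) < R" for z
  proof (cases "z = 0")
    case True
    have "(\<lambda>n. e n * (z - 0) ^ n) = (\<lambda>n. 0)"
      using True by (auto simp: e_def fun_eq_iff power_0_left split: nat.splits)
    thus ?thesis by simp
  next
    case False
    have "(\<lambda>n. z * (b n * z ^ n - d n * z ^ n)) sums (z * (f z - f z))"
      using that False by (intro sums_mult sums_diff b d) auto
    hence "(\<lambda>n. e (Suc n) * (z - 0) ^ Suc n) sums 0"
      by (simp add: e_def algebra_simps)
    thus ?thesis by (subst (asm) sums_Suc_iff) (simp add: e_def)
  qed
  have "e (Suc m) \<noteq> 0" "Suc m > 0" using m by (auto simp: e_def)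
  \<comment> \<open>A power series with a nonzero coefficient of positive index that vanishes at
    \<open>0\<close> has an isolated zero there; applied to the zero function this is
    absurd.\<close>
  then obtain s where s: "s > 0" "\<And>z. z \<in> cball 0 s - {0 :: complex} \<Longrightarrow> (0 :: complex) \<noteq> 0"
    using powser_0_nonzero[OF R e refl] by blast
  have "complex_of_real s \<in> cball 0 s - {0}" using s(1) by auto
  from s(2)[OF this] show False by simp
qed

text \<open>By the identity theorem \<open>f - g\<close> vanishes off a sparse set. At the remaining
  points niceness fixes the value: \<open>0\<close> at a pole, the limit elsewhere.\<close>

lemma nicely_meromorphic_on_UNIV_unique:
  assumes f: "f nicely_meromorphic_on UNIV" and g: "g nicely_meromorphic_on UNIV"
    and U: "open U" "x \<in> U" and eq: "\<And>z. z \<in> U \<Longrightarrow> f z = g z"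
  shows "f = g"
proof
  fix z
  have mero: "(\<lambda>z. f z - g z) meromorphic_on UNIV"
    using f g by (auto simp: nicely_meromorphic_on_def intro!: meromorphic_intros)
  have "eventually (\<lambda>z. f z - g z = 0) (at x)"
    using eventually_at_in_open'[OF U] by eventually_elim (simp add: eq)
  \<comment> \<open>Agreement near \<open>x\<close> rules out that \<open>f - g\<close> avoids
    \<open>0\<close> off a sparse set, which leaves only the constant case.\<close>
  hence "\<not> eventually (\<lambda>z. f z - g z \<noteq> 0) (at x)"
    by (metis (mono_tags, lifting) eventually_conj eventually_frequently frequently_def at_neq_bot not_eventuallyD)
  hence "\<not> eventually (\<lambda>z. f z - g z \<noteq> 0) (cosparse UNIV)"
    by (auto simp: eventually_cosparse_open_eq)
  hence "eventually (\<lambda>z. f z - g z = 0) (cosparse UNIV)"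
    using meromorphic_imp_constant_or_avoid[OF mero open_UNIV connected_UNIV, of 0] by blast
  hence ev: "eventually (\<lambda>z. f z = g z) (at z)"
    by (auto simp: eventually_cosparse_open_eq)
  show "f z = g z"
  proof (cases "is_pole f z")
    case True
    hence "is_pole g z" using is_pole_cong[OF ev refl] by simp
    moreover have "\<not> h \<midarrow>z\<rightarrow> h z" if "is_pole h z" for h :: "complex \<Rightarrow> complex"
      using that not_tendsto_and_filterlim_at_infinity[OF at_neq_bot]
      by (auto simp: is_pole_def)
    ultimately show ?thesis using True f g
      by (metis UNIV_I nicely_meromorphic_on_def)
  next
    case False
    hence "\<not> is_pole g z" using is_pole_cong[OF ev refl] by simp
    hence "g \<midarrow>z\<rightarrow> g z" "f \<midarrow>z\<rightarrow> f z"
      using False f g by (auto simp: nicely_meromorphic_on_def)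
    moreover have "g \<midarrow>z\<rightarrow> f z"
      by (rule Lim_transform_eventually[OF \<open>f \<midarrow>z\<rightarrow> f z\<close> ev])
    ultimately show ?thesis using LIM_unique by blast
  qed
qed

subsection \<open>The Mellin transform representation\<close>

locale barnes_weights =
  fixes r :: nat and w :: "nat \<Rightarrow> real" and a :: real
  assumes r_pos: "r \<ge> 1" and a_pos: "a > 0" and w_pos: "i \<in> {1..r} \<Longrightarrow> w i > 0"
begin

definition tuples :: "(nat \<Rightarrow> nat) set" where
  "tuples = {1..r} \<rightarrow>\<^sub>E UNIV"

definition term_base :: "(nat \<Rightarrow> nat) \<Rightarrow> real" where
  "term_base m = a + (\<Sum>i=1..r. real (m i) * w i)"

text \<open>The function whose Mellin transform is \<open>Gamma\<close> times the Barnes zeta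
  function: for \<open>t > 0\<close> it is the sum of \<open>exp (- term_base m * t)\<close> over
  all tuples \<open>m\<close>.\<close>

definition kernel :: "real \<Rightarrow> real" where
  "kernel t = exp (- a * t) / (\<Prod>i=1..r. 1 - exp (- w i * t))"

lemma kernel_measurable [measurable]: "kernel \<in> borel_measurable borel"
  unfolding kernel_def by measurable

lemma term_base_pos: "term_base m > 0"
  unfolding term_base_def using a_pos w_pos
  by (intro add_pos_nonneg sum_nonneg mult_nonneg_nonneg less_imp_le[OF w_pos]) auto

lemma kernel_pos: "t > 0 \<Longrightarrow> kernel t > 0"
  unfolding kernel_def using w_pos by (intro divide_pos_pos prod_pos) auto

lemma countable_tuples: "countable tuples"
  unfolding tuples_def by (intro countable_PiE) auto

lemma infinite_tuples: "infinite tuples"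
  using r_pos by (auto simp: tuples_def finite_PiE_iff PiE_eq_empty_iff)

text \<open>A product of \<open>r\<close> geometric series, multiplied out into one sum over tuples;
  absolute summability justifies the expansion.\<close>

lemma kernel_has_sum:
  assumes t: "t > 0"
  shows "((\<lambda>m. exp (- term_base m * t)) has_sum kernel t) tuples"
proof -
  define f where "f = (\<lambda>i (n::nat). exp (- w i * t) ^ n)"
  have f: "f i sums (1 / (1 - exp (- w i * t)))" "summable (\<lambda>n. norm (f i n))" if "i \<in> {1..r}" for i
    unfolding f_def using w_pos[OF that] t
    by (auto intro!: geometric_sums summable_geometric)
  have hs: "(f i has_sum (1 / (1 - exp (- w i * t)))) UNIV" if "i \<in> {1..r}" for i
    by (rule norm_summable_imp_has_sum) (use f[OF that] in auto)
  have abs: "Infinite_Set_Sum.abs_summable_on (f i) UNIV" if "i \<in> {1..r}" for i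
    using f(2)[OF that] by (simp add: abs_summable_on_nat_iff')
  have "Infinite_Set_Sum.abs_summable_on (\<lambda>m. \<Prod>i\<in>{1..r}. f i (m i)) ({1..r} \<rightarrow>\<^sub>E UNIV)"
    by (rule abs_summable_on_prod_PiE) (use abs in auto)
  hence summ: "(\<lambda>m. \<Prod>i\<in>{1..r}. f i (m i)) summable_on tuples"
    unfolding tuples_def by (metis abs_summable_equivalent abs_summable_summable)
  have "infsum (\<lambda>m. \<Prod>i\<in>{1..r}. f i (m i)) tuples = (\<Prod>i\<in>{1..r}. infsum (f i) UNIV)"
    unfolding tuples_def
    by (rule infsum_prod_PiE) (use has_sum_imp_summable[OF hs] summ in \<open>auto simp: tuples_def\<close>)
  also have "\<dots> = (\<Prod>i\<in>{1..r}. 1 / (1 - exp (- w i * t)))"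
    by (intro prod.cong refl infsumI hs)
  finally have "((\<lambda>m. \<Prod>i\<in>{1..r}. f i (m i)) has_sum (\<Prod>i\<in>{1..r}. 1 / (1 - exp (- w i * t)))) tuples"
    using has_sum_infsum[OF summ] by simp
  from has_sum_cmult_right[OF this, of "exp (- a * t)"]
  have "((\<lambda>m. exp (- a * t) * (\<Prod>i\<in>{1..r}. f i (m i))) has_sum kernel t) tuples"
    by (simp add: kernel_def prod_dividef)
  moreover have "exp (- a * t) * (\<Prod>i\<in>{1..r}. f i (m i)) = exp (- term_base m * t)" for m
    by (simp add: term_base_def f_def exp_of_nat_mult[symmetric] exp_sum[symmetric]
         exp_add[symmetric] sum_negf sum_distrib_left sum_distrib_right algebra_simps)
  ultimately show ?thesis by simp
qed

text \<open>Lists the tuples in a sequence, so that the unordered sum becomes a series that can be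
  integrated term by term with \<open>sums_integral\<close>.\<close>

definition enum :: "nat \<Rightarrow> real" where
  "enum n = term_base (from_nat_into tuples n)"

lemma bij_tuples: "bij_betw (from_nat_into tuples) UNIV tuples"
  by (rule bij_betw_from_nat_into[OF countable_tuples infinite_tuples])

lemma enum_pos: "enum n > 0"
  by (simp add: enum_def term_base_pos)

lemma kernel_sums:
  assumes "t > 0"
  shows "(\<lambda>n. exp (- enum n * t)) sums kernel t"
  using kernel_has_sum[OF assms] has_sum_reindex_bij_betw[OF bij_tuples, of "\<lambda>m. exp (- term_base m * t)"]
  by (auto simp: enum_def intro: has_sum_imp_sums)

text \<open>Each of the \<open>r\<close> factors is at most a constant times \<open>1 + 1/t\<close>,
  which gives order \<open>t powr (- r)\<close> at \<open>0\<close>; the numerator supplies the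
  exponential decay.\<close>

lemma kernel_le:
  obtains C where "C > 0" "\<And>t. t > 0 \<Longrightarrow> kernel t \<le> C * (1 + t powr (- real r)) * exp (- a * t)"
proof
  let ?K = "\<Prod>i=1..r. 1 + 1 / w i"
  have K: "?K > 0"
    using w_pos by (intro prod_pos) (auto intro!: add_pos_pos)
  thus "?K * 2 ^ r > 0" by simp
  fix t :: real assume t: "t > 0"
  have "(\<Prod>i=1..r. 1 / (1 - exp (- w i * t))) \<le> (\<Prod>i=1..r. (1 + 1 / w i) * (1 + 1 / t))"
  proof (rule prod_mono)
    fix i assume "i \<in> {1..r}"
    thus "0 \<le> 1 / (1 - exp (- w i * t)) \<and> 1 / (1 - exp (- w i * t)) \<le> (1 + 1 / w i) * (1 + 1 / t)"
      using inverse_one_minus_exp_le[of "w i" t] w_pos[of i] t by auto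
  qed
  also have "\<dots> = ?K * (1 + 1 / t) ^ r"
    by (simp add: prod.distrib)
  also have "\<dots> \<le> ?K * (2 ^ r * (1 + t powr (- real r)))"
    using K t by (intro mult_left_mono one_add_inverse_power_le) auto
  finally show "kernel t \<le> ?K * 2 ^ r * (1 + t powr (- real r)) * exp (- a * t)"
    using mult_right_mono[of _ _ "exp (- a * t)"]
    by (fastforce simp: kernel_def prod_dividef mult_ac)
qed

text \<open>The bound \<open>kernel_le\<close> splits into two Gamma integrands, with parameters
  \<open>x\<close> and \<open>x - r\<close>; the second converges because
  \<open>x > r\<close>.\<close>

lemma kernel_powr_integrable:
  fixes x :: real
  assumes x: "x > real r"
  shows "set_integrable lborel {0<..} (\<lambda>t. t powr (x - 1) * kernel t)"
proof -
  obtain C where C: "C > 0" "\<And>t. t > 0 \<Longrightarrow> kernel t \<le> C * (1 + t powr (- real r)) * exp (- a * t)"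
    using kernel_le by blast
  let ?h = "\<lambda>t. C * (t powr (x - 1) * exp (- a * t)) + C * (t powr (x - real r - 1) * exp (- a * t))"
  have "set_integrable lborel {0<..} ?h"
    using a_pos x by (intro set_integral_add set_integrable_mult_right set_integrable_powr_exp_real) auto
  thus ?thesis
  proof (rule set_integrable_bound)
    show "AE t in lborel. t \<in> {0<..} \<longrightarrow> norm (t powr (x - 1) * kernel t) \<le> norm (?h t)"
    proof (intro AE_I2 impI)
      fix t :: real assume "t \<in> {0<..}"
      hence t: "t > 0" by simp
      have "norm (t powr (x - 1) * kernel t) = t powr (x - 1) * kernel t"
        using kernel_pos[OF t] by simp
      also have "\<dots> \<le> t powr (x - 1) * (C * (1 + t powr (- real r)) * exp (- a * t))"
        by (intro mult_left_mono C t) auto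
      also have "\<dots> = ?h t"
        using t by (simp add: algebra_simps powr_add[symmetric])
      finally show "norm (t powr (x - 1) * kernel t) \<le> norm (?h t)"
        by simp
    qed
  qed (auto simp: set_borel_measurable_def)
qed

lemma kernel_cpowr_integrable:
  assumes s: "Re s > real r"
  shows "set_integrable lborel {0<..} (\<lambda>t. of_real t powr (s - 1) * complex_of_real (kernel t))"
  by (rule set_integrable_bound[OF kernel_powr_integrable[OF s]])
     (auto simp: set_borel_measurable_def norm_mult norm_powr_real_powr)

text \<open>Away from \<open>0\<close> only the decay at infinity matters, so every complex
  \<open>s\<close> is allowed.\<close>

lemma kernel_cpowr_integrable_atLeast:
  assumes c: "c > 0"
  shows "set_integrable lborel {c..} (\<lambda>t. of_real t powr (s - 1) * complex_of_real (kernel t))"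
proof -
  \<comment> \<open>Large enough for the integral from \<open>0\<close> to converge, and above
    \<open>Re s\<close>, so that \<open>t powr (Re s - x)\<close> is largest at
    \<open>t = c\<close>.\<close>
  define x where "x = max (Re s) (real r) + 1"
  have "set_integrable lborel {c..} (\<lambda>t. t powr (x - 1) * kernel t)"
    by (rule set_integrable_subset[OF kernel_powr_integrable]) (use c in \<open>auto simp: x_def\<close>)
  hence "set_integrable lborel {c..} (\<lambda>t. c powr (Re s - x) * (t powr (x - 1) * kernel t))"
    by simp
  thus ?thesis
  proof (rule set_integrable_bound)
    show "AE t in lborel. t \<in> {c..} \<longrightarrow> norm (of_real t powr (s - 1) * complex_of_real (kernel t))
            \<le> norm (c powr (Re s - x) * (t powr (x - 1) * kernel t))"
    proof (intro AE_I2 impI)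
      fix t :: real assume "t \<in> {c..}"
      hence t: "t \<ge> c" "t > 0" using c by auto
      have "t powr (Re s - 1) = t powr (Re s - x) * t powr (x - 1)"
        by (simp add: powr_add[symmetric])
      also have "\<dots> \<le> c powr (Re s - x) * t powr (x - 1)"
        using t c by (intro mult_right_mono powr_mono2') (auto simp: x_def)
      finally show "norm (of_real t powr (s - 1) * complex_of_real (kernel t))
            \<le> norm (c powr (Re s - x) * (t powr (x - 1) * kernel t))"
        using kernel_pos[OF t(2)] t(2) by (simp add: norm_mult norm_powr_real_powr)
    qed
  qed (auto simp: set_borel_measurable_def)
qed

text \<open>Expand \<open>kernel\<close> into exponentials and exchange sum and integral; each
  exponential contributes \<open>Gamma s\<close> times one term of the series.\<close>

lemma Gamma_barnes_series:
  assumes s: "Re s > real r"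
  shows "Gamma s * barnes_series r w a s =
           (LINT t:{0<..}|lborel. of_real t powr (s - 1) * complex_of_real (kernel t))"
proof -
  let ?f = "\<lambda>n t. indicator {0<..} t *\<^sub>R (complex_of_real t powr (s - 1) * of_real (exp (- enum n * t)))"
  let ?F = "\<lambda>t. indicator {0<..} t *\<^sub>R (t powr (Re s - 1) * kernel t)"
  have s0: "Re s > 0" using s by linarith
  have int: "integrable lborel (?f n)" for n
    using set_integrable_powr_exp[OF enum_pos s0] by (simp add: set_integrable_def)
  have intF: "integrable lborel ?F"
    using kernel_powr_integrable[OF s] by (simp add: set_integrable_def)
  have normf: "norm (?f n t) = indicator {0<..} t * (t powr (Re s - 1) * exp (- enum n * t))" for n t
    by (auto simp: indicator_def norm_mult norm_powr_real_powr)
  have sumf: "(\<lambda>n. ?f n t) sums (indicator {0<..} t *\<^sub>R (of_real t powr (s - 1) * of_real (kernel t)))" for t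
  proof (cases "t > 0")
    case True
    show ?thesis using kernel_sums[OF True]
      by (intro sums_scaleR_right sums_mult) (simp only: sums_of_real_iff)
  qed auto
  have sumn: "(\<lambda>n. norm (?f n t)) sums ?F t" for t
  proof (cases "t > 0")
    case True
    show ?thesis unfolding normf using kernel_sums[OF True] True
      by (auto intro!: sums_mult)
  qed auto
  \<comment> \<open>The norms add up pointwise to \<open>?F\<close>, the same integrand with
    \<open>Re s\<close> for \<open>s\<close>, so its finite integral bounds all partial
    sums.\<close>
  have summ: "summable (\<lambda>n. LINT t|lborel. norm (?f n t))"
  proof (rule summableI_nonneg_bounded)
    fix n
    have "(\<Sum>i<n. LINT t|lborel. norm (?f i t)) = (LINT t|lborel. (\<Sum>i<n. norm (?f i t)))"
      by (rule Bochner_Integration.integral_sum[symmetric]) (intro integrable_norm int)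
    also have "\<dots> \<le> integral\<^sup>L lborel ?F"
    proof (rule integral_mono)
      show "integrable lborel (\<lambda>t. \<Sum>i<n. norm (?f i t))"
        by (intro Bochner_Integration.integrable_sum integrable_norm int)
      show "(\<Sum>i<n. norm (?f i t)) \<le> ?F t" for t
        using sum_le_suminf[OF sums_summable[OF sumn[of t]], of "{..<n}"] sums_unique[OF sumn[of t]]
        by simp
    qed (rule intF)
    finally show "(\<Sum>i<n. LINT t|lborel. norm (?f i t)) \<le> integral\<^sup>L lborel ?F" .
  qed simp
  have sumAE: "AE t in lborel. summable (\<lambda>n. norm (?f n t))"
    using sumn by (auto simp: sums_iff)
  have f_int: "integral\<^sup>L lborel (?f n) = Gamma s * of_real (enum n) powr (- s)" for n
    using set_integral_powr_exp_eq[OF enum_pos s0] by (simp add: set_lebesgue_integral_def)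
  have "(\<lambda>n. integral\<^sup>L lborel (?f n)) sums (LINT t|lborel. (\<Sum>n. ?f n t))"
    by (rule sums_integral[OF int sumAE summ])
  also have "(\<lambda>t. \<Sum>n. ?f n t) = (\<lambda>t. indicator {0<..} t *\<^sub>R (of_real t powr (s - 1) * of_real (kernel t)))"
    using sumf by (auto simp: sums_iff)
  finally have *: "(\<lambda>n. Gamma s * of_real (enum n) powr (- s)) sums
       (LINT t:{0<..}|lborel. of_real t powr (s - 1) * complex_of_real (kernel t))"
    unfolding f_int set_lebesgue_integral_def .
  \<comment> \<open>Absolute convergence makes the order of \<open>enum\<close> immaterial and leads
    back to the unordered sum over tuples.\<close>
  have "summable (\<lambda>n. norm (Gamma s * of_real (enum n) powr (- s)))"
  proof (rule summable_comparison_test'[OF summ, of 0])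
    show "norm (norm (Gamma s * of_real (enum n) powr (- s))) \<le> (LINT t|lborel. norm (?f n t))" for n
      unfolding f_int[symmetric] real_norm_def abs_norm_cancel by (rule integral_norm_bound)
  qed
  from norm_summable_imp_has_sum[OF this *]
  have "((\<lambda>m. Gamma s * of_real (term_base m) powr (- s)) has_sum
       (LINT t:{0<..}|lborel. of_real t powr (s - 1) * complex_of_real (kernel t))) tuples"
    unfolding enum_def by (subst (asm) has_sum_reindex_bij_betw[OF bij_tuples])
  hence "(\<Sum>\<^sub>\<infinity>m\<in>tuples. Gamma s * of_real (term_base m) powr (- s)) =
       (LINT t:{0<..}|lborel. of_real t powr (s - 1) * complex_of_real (kernel t))"
    by (rule infsumI)
  thus ?thesis
    by (simp add: infsum_cmult_right' barnes_series_def tuples_def term_base_def)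
qed

subsection \<open>The Bernoulli expansion near the origin\<close>

definition radius :: real where
  "radius = Min ((\<lambda>i. 2 * pi / w i) ` {1..r})"

lemma radius_pos: "radius > 0"
  unfolding radius_def using r_pos w_pos by (subst Min_gr_iff) auto

text \<open>\<open>gen_fun 0 = 0\<close> is a junk value (division by zero); only \<open>t \<noteq> 0\<close> matters.\<close>
definition gen_fun :: "complex \<Rightarrow> complex" where
  "gen_fun t = t ^ r * exp (of_real ((\<Sum>i=1..r. w i) - a) * t) /
                 (\<Prod>i=1..r. (exp (of_real (w i) * t) - 1))"

text \<open>The solutions are \<open>z = 2 * pi * i * n / w i\<close> with integer \<open>n\<close>;
  those with nonzero \<open>n\<close> have modulus at least \<open>radius\<close>.\<close>

lemma exp_eq_1_in_radius:
  fixes z :: complex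
  assumes i: "i \<in> {1..r}" and z: "norm z < radius" and e: "exp (of_real (w i) * z) = 1"
  shows "z = 0"
proof (rule ccontr)
  assume "z \<noteq> 0"
  have wi: "w i > 0" using w_pos[OF i] .
  from e have re: "Re z = 0" and "\<exists>n::int. w i * Im z = of_int (2 * n) * pi"
    using wi by (auto simp: exp_eq_1)
  then obtain n :: int where n: "w i * Im z = of_int (2 * n) * pi" by blast
  have "n \<noteq> 0" using n wi re \<open>z \<noteq> 0\<close> by (auto simp: complex_eq_iff)
  hence "1 \<le> \<bar>real_of_int n\<bar>" by linarith
  hence "2 * pi \<le> 2 * pi * \<bar>real_of_int n\<bar>" by simp
  also have "\<dots> = \<bar>w i * Im z\<bar>" using n by (simp add: abs_mult)
  also have "\<dots> = w i * norm z" using re wi by (simp add: cmod_def abs_mult)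
  finally have "2 * pi / w i \<le> norm z" using wi by (simp add: field_simps)
  moreover have "radius \<le> 2 * pi / w i"
    unfolding radius_def using i by (intro Min_le) auto
  ultimately show False using z by simp
qed

text \<open>The factor \<open>t ^ r\<close> cancels the \<open>r\<close> simple zeros of the
  denominator at \<open>0\<close>, one \<open>t\<close> for each factor.\<close>

lemma gen_fun_holomorphic_extension:
  obtains g :: "complex \<Rightarrow> complex" where "g holomorphic_on ball 0 radius"
    "\<And>z. z \<in> ball 0 radius - {0} \<Longrightarrow> g z = gen_fun z"
proof -
  define q :: "nat \<Rightarrow> complex \<Rightarrow> complex" where "q = (\<lambda>i z. if z = 0 then of_real (w i) else (exp (of_real (w i) * z) - 1) / z)"
  have "deriv (\<lambda>z::complex. exp (of_real (w i) * z)) 0 = of_real (w i)" for i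
    by (rule DERIV_imp_deriv) (auto intro!: derivative_eq_intros)
  \<comment> \<open>Rewritten as a difference quotient completed by the derivative, the form in
    which \<open>pole_lemma\<close> gives holomorphy.\<close>
  hence q_eq: "q i = (\<lambda>z. if z = 0 then deriv (\<lambda>z. exp (of_real (w i) * z)) 0 else
      ((\<lambda>z. exp (of_real (w i) * z)) z - (\<lambda>z. exp (of_real (w i) * z)) 0) / (z - 0))" for i
    by (auto simp: q_def fun_eq_iff)
  have q_holo: "q i holomorphic_on ball 0 radius" for i
    unfolding q_eq by (rule pole_lemma) (use radius_pos in \<open>auto intro!: holomorphic_intros\<close>)
  have q_nz: "q i z \<noteq> 0" if "i \<in> {1..r}" "z \<in> ball 0 radius" for i z
    using that exp_eq_1_in_radius[of i z] w_pos[of i] by (auto simp: q_def)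
  show ?thesis
  proof (rule that)
    show "(\<lambda>z::complex. exp (of_real ((\<Sum>i=1..r. w i) - a) * z) / (\<Prod>i=1..r. q i z)) holomorphic_on ball 0 radius"
      using q_nz by (intro holomorphic_intros q_holo) auto
    fix z :: complex assume "z \<in> ball 0 radius - {0}"
    hence "z \<noteq> 0" by simp
    thus "exp (of_real ((\<Sum>i=1..r. w i) - a) * z) / (\<Prod>i=1..r. q i z) = gen_fun z"
      by (simp add: q_def gen_fun_def prod_dividef)
  qed
qed

lemma gen_fun_cnj: "gen_fun (cnj z) = cnj (gen_fun z)"
  by (simp add: gen_fun_def cnj_prod exp_cnj)

text \<open>The Taylor coefficient of the generating function, as \<open>bern_sums\<close> shows. It
  has the sign of the Bernoulli value.\<close>

definition bern :: "nat \<Rightarrow> real" where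
  "bern n = barnes_bernoulli r n a w / fact n"

text \<open>Evaluates the definite description behind \<open>barnes_bernoulli\<close>: the Taylor
  coefficients of the holomorphic extension exist, are real and are unique.\<close>

lemma bern_sums:
  assumes z: "z \<noteq> 0" "norm z < radius"
  shows "(\<lambda>n. of_real (bern n) * z ^ n) sums gen_fun z"
proof -
  obtain g :: "complex \<Rightarrow> complex" where g: "g holomorphic_on ball 0 radius"
    "\<And>z. z \<in> ball 0 radius - {0} \<Longrightarrow> g z = gen_fun z"
    using gen_fun_holomorphic_extension by blast
  define b where "b = (\<lambda>n. (deriv ^^ n) g 0 / fact n)"
  have b: "(\<lambda>n. b n * z ^ n) sums gen_fun z" if "z \<noteq> 0" "norm z < radius" for z
    using holomorphic_power_series[OF g(1), of z] g(2)[of z] that by (simp add: b_def)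
  \<comment> \<open>The generating function commutes with conjugation, so the conjugated
    coefficients represent it too; by uniqueness they equal \<open>b\<close>.\<close>
  have b': "(\<lambda>n. cnj (b n) * z ^ n) sums gen_fun z" if "z \<noteq> 0" "norm z < radius" for z
    using b[of "cnj z"] that by (subst sums_cnj[symmetric]) (simp add: gen_fun_cnj)
  have "b = (\<lambda>n. cnj (b n))"
    by (rule powser_punctured_unique[OF radius_pos b b'])
  hence real: "of_real (Re (b n)) = b n" for n
    by (metis Reals_cnj_iff of_real_Re)
  define P where "P = (\<lambda>B :: nat \<Rightarrow> real. \<forall>t::complex. t \<noteq> 0 \<and> norm t < radius \<longrightarrow>
      (\<lambda>n. of_real (B n) * t ^ n / fact n) sums gen_fun t)"
  have P: "P (\<lambda>n. fact n * Re (b n))"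
    unfolding P_def using b by (simp add: real)
  have "(THE B. P B) = (\<lambda>n. fact n * Re (b n))"
  proof (rule the_equality, rule P)
    fix B assume "P B"
    have "(\<lambda>n. complex_of_real (B n) / fact n) = b"
      by (rule powser_punctured_unique[OF radius_pos _ b]) (use \<open>P B\<close> in \<open>auto simp: P_def\<close>)
    hence "complex_of_real (B n / fact n) = b n" for n
      by (auto simp: fun_eq_iff)
    hence "B n / fact n = Re (b n)" for n
      by (metis Re_complex_of_real)
    thus "B = (\<lambda>n. fact n * Re (b n))"
      by (auto simp: fun_eq_iff field_simps)
  qed
  moreover have "barnes_bernoulli r n a w = (THE B. P B) n" for n
    by (simp add: barnes_bernoulli_def P_def radius_def gen_fun_def)
  ultimately have "of_real (bern n) = b n" for n
    by (simp add: bern_def real)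
  thus ?thesis using b[OF z] by simp
qed

text \<open>Pulling \<open>exp (w i * t)\<close> out of each denominator factor cancels the sum of
  the weights in the exponent of the numerator.\<close>

lemma gen_fun_kernel:
  assumes t: "t > 0"
  shows "gen_fun (of_real t) = of_real (t ^ r * kernel t)"
proof -
  have "exp (w i * t) - 1 = exp (w i * t) * (1 - exp (- w i * t))" for i
    by (simp add: right_diff_distrib exp_add[symmetric])
  hence "(\<Prod>i=1..r. exp (w i * t) - 1) = exp ((\<Sum>i=1..r. w i) * t) * (\<Prod>i=1..r. 1 - exp (- w i * t))"
    by (simp add: prod.distrib exp_sum sum_distrib_right)
  moreover have "exp (((\<Sum>i=1..r. w i) - a) * t) = exp ((\<Sum>i=1..r. w i) * t) * exp (- a * t)"
    by (simp add: exp_add[symmetric] algebra_simps)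
  ultimately have "t ^ r * exp (((\<Sum>i=1..r. w i) - a) * t) / (\<Prod>i=1..r. exp (w i * t) - 1) = t ^ r * kernel t"
    by (simp add: kernel_def)
  moreover have "gen_fun (of_real t) =
      of_real (t ^ r * exp (((\<Sum>i=1..r. w i) - a) * t) / (\<Prod>i=1..r. exp (w i * t) - 1))"
    by (simp add: gen_fun_def exp_of_real[symmetric])
  ultimately show ?thesis by simp
qed

section \<open>The Mellin integral near the origin\<close>

definition cutoff :: real where "cutoff = radius / 2"

lemma cutoff_pos: "cutoff > 0" using radius_pos by (simp add: cutoff_def)

lemma summable_bern: 
  assumes "0 \<le> t" "t \<le> cutoff"
  shows "summable (\<lambda>n. \<bar>bern n\<bar> * t ^ n)"
proof -
  \<comment> \<open>Convergence at a point strictly between \<open>cutoff\<close> and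
    \<open>radius\<close> gives absolute convergence up to and including
    \<open>cutoff\<close>.\<close>
  have "summable (\<lambda>n. of_real (bern n) * (of_real (3/4 * radius) :: complex) ^ n)"
    by (rule sums_summable[OF bern_sums]) (use radius_pos in auto)
  from powser_insidea[OF this, of "of_real t"] show ?thesis
    using assms radius_pos by (simp add: norm_mult norm_power cutoff_def)
qed

text \<open>Term-by-term integration of the Bernoulli expansion; the power \<open>t ^ r\<close> in
  the generating function accounts for the shift by \<open>r\<close>.\<close>

lemma kernel_mellin_near_0:
  assumes s: "Re s > real r"
  shows "(LINT t:{0<..<cutoff}|lborel. of_real t powr (s - 1) * complex_of_real (kernel t)) =
           of_real cutoff powr (s - of_nat r) *
           (\<Sum>n. of_real (bern n * cutoff ^ n) / (s + of_nat n - of_nat r))"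
proof -
  let ?f = "\<lambda>n t. of_real (bern n) * (indicator {0<..<cutoff} t *\<^sub>R (complex_of_real t powr (s + of_nat n - of_nat r - 1)))"
  have re: "Re (s + of_nat n - of_nat r) > 0" for n
    using s by simp
  have int: "integrable lborel (?f n)" for n
    using set_integral_cpowr_0(1)[OF re cutoff_pos, of n]
    unfolding set_integrable_def by (rule integrable_mult_right)
  have f_int: "integral\<^sup>L lborel (?f n) = of_real cutoff powr (s - of_nat r) *
      (of_real (bern n * cutoff ^ n) / (s + of_nat n - of_nat r))" for n
  proof -
    have "integral\<^sup>L lborel (?f n) = of_real (bern n) * (of_real cutoff powr (s + of_nat n - of_nat r) / (s + of_nat n - of_nat r))"
      using set_integral_cpowr_0(2)[OF re cutoff_pos, of n]
      unfolding set_lebesgue_integral_def by (simp only: integral_mult_right_zero)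
    also have "s + of_nat n - of_nat r = (s - of_nat r) + of_nat n" by simp
    also have "complex_of_real cutoff powr ((s - of_nat r) + of_nat n) = of_real cutoff powr (s - of_nat r) * of_real cutoff ^ n"
      using cutoff_pos by (simp only: powr_add powr_nat) simp
    finally show ?thesis by (simp add: algebra_simps)
  qed
  have normf: "norm (?f n t) = \<bar>bern n\<bar> * (indicator {0<..<cutoff} t *\<^sub>R t powr (Re s + real n - real r - 1))" for n t
    by (auto simp: indicator_def norm_mult norm_powr_real_powr)
  have normf_int: "(LINT t|lborel. norm (?f n t)) \<le>
      (cutoff powr (Re s - real r) / (Re s - real r)) * (\<bar>bern n\<bar> * cutoff ^ n)" for n
  proof -
    have x: "Re s + real n - real r > 0" using s by simp
    have "(LINT t|lborel. norm (?f n t)) = \<bar>bern n\<bar> * (cutoff powr (Re s + real n - real r) / (Re s + real n - real r))"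
      unfolding normf using set_integrable_powr_0(2)[OF x cutoff_pos] by (simp add: set_lebesgue_integral_def)
    \<comment> \<open>Dropping \<open>n\<close> from the denominator, which stays positive, leaves a
      constant times a term of the summable series at \<open>cutoff\<close>.\<close>
    also have "\<dots> \<le> \<bar>bern n\<bar> * (cutoff powr (Re s + real n - real r) / (Re s - real r))"
      using s by (intro mult_left_mono divide_left_mono) auto
    also have "cutoff powr (Re s + real n - real r) = cutoff powr (Re s - real r) * cutoff ^ n"
      using cutoff_pos by (simp add: powr_add[symmetric] powr_realpow[symmetric] algebra_simps)
    finally show ?thesis by (simp add: field_simps)
  qed
  have summ: "summable (\<lambda>n. LINT t|lborel. norm (?f n t))"
  proof (rule summable_comparison_test'[of _ 0])
    show "summable (\<lambda>n. (cutoff powr (Re s - real r) / (Re s - real r)) * (\<bar>bern n\<bar> * cutoff ^ n))"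
      by (intro summable_mult summable_bern) (use cutoff_pos in auto)
    show "norm (LINT t|lborel. norm (?f n t)) \<le> (cutoff powr (Re s - real r) / (Re s - real r)) * (\<bar>bern n\<bar> * cutoff ^ n)" for n
    proof -
      have "(LINT t|lborel. norm (?f n t)) \<ge> 0"
        by (rule Bochner_Integration.integral_nonneg) (rule norm_ge_zero)
      thus ?thesis using normf_int[of n] by (simp only: real_norm_def abs_of_nonneg)
    qed
  qed
  have powr_eq: "complex_of_real t powr (s + of_nat n - of_nat r - 1) = of_real t powr (s - of_nat r - 1) * of_real t ^ n"
    if "t > 0" for t n
  proof -
    have "s + of_nat n - of_nat r - 1 = (s - of_nat r - 1) + of_nat n" by simp
    thus ?thesis using that by (simp only: powr_add powr_nat) simp
  qed
  have sumAE: "AE t in lborel. summable (\<lambda>n. norm (?f n t))"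
  proof (intro AE_I2)
    fix t :: real
    show "summable (\<lambda>n. norm (?f n t))"
    proof (cases "t \<in> {0<..<cutoff}")
      case True
      hence "summable (\<lambda>n. norm (complex_of_real t powr (s - of_nat r - 1)) * (\<bar>bern n\<bar> * t ^ n))"
        by (intro summable_mult summable_bern) auto
      thus ?thesis using True by (simp add: powr_eq norm_mult norm_power mult_ac)
    qed auto
  qed
  have sumf: "(\<lambda>n. ?f n t) sums (indicator {0<..<cutoff} t *\<^sub>R (of_real t powr (s - 1) * of_real (kernel t)))" for t
  proof (cases "t \<in> {0<..<cutoff}")
    case True
    have "(\<lambda>n. of_real t powr (s - of_nat r - 1) * (of_real (bern n) * of_real t ^ n)) sums
       (of_real t powr (s - of_nat r - 1) * gen_fun (of_real t))"
      by (intro sums_mult bern_sums) (use True radius_pos in \<open>auto simp: cutoff_def\<close>)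
    moreover have "complex_of_real t powr (s - of_nat r - 1) * of_real t ^ r = of_real t powr (s - 1)"
      using powr_eq[of t r] True by simp
    ultimately have "(\<lambda>n. of_real t powr (s - of_nat r - 1) * (of_real (bern n) * of_real t ^ n)) sums
       (indicator {0<..<cutoff} t *\<^sub>R (of_real t powr (s - 1) * of_real (kernel t)))"
      using True by (simp add: gen_fun_kernel flip: mult.assoc)
    moreover have "of_real t powr (s - of_nat r - 1) * (of_real (bern n) * of_real t ^ n) = ?f n t" for n
      using True by (simp add: powr_eq mult_ac)
    ultimately show ?thesis by simp
  qed auto
  have "(\<lambda>n. integral\<^sup>L lborel (?f n)) sums (LINT t|lborel. (\<Sum>n. ?f n t))"
    by (rule sums_integral[OF int sumAE summ])
  also have "(\<lambda>t. \<Sum>n. ?f n t) = (\<lambda>t. indicator {0<..<cutoff} t *\<^sub>R (of_real t powr (s - 1) * of_real (kernel t)))"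
    using sumf by (auto simp: sums_iff)
  finally have *: "(\<lambda>n. of_real cutoff powr (s - of_nat r) *
      (of_real (bern n * cutoff ^ n) / (s + of_nat n - of_nat r))) sums
       (LINT t:{0<..<cutoff}|lborel. of_real t powr (s - 1) * complex_of_real (kernel t))"
    unfolding f_int set_lebesgue_integral_def .
  hence "(\<lambda>n. of_real (bern n * cutoff ^ n) / (s + of_nat n - of_nat r)) sums
     (inverse (of_real cutoff powr (s - of_nat r)) *
       (LINT t:{0<..<cutoff}|lborel. of_real t powr (s - 1) * complex_of_real (kernel t)))"
    using cutoff_pos by (auto dest: sums_mult[where c = "inverse (of_real cutoff powr (s - of_nat r))"] simp: field_simps)
  thus ?thesis using cutoff_pos by (simp add: sums_iff field_simps)
qed

subsection \<open>Meromorphic continuation\<close>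

definition upper :: "complex \<Rightarrow> complex" where
  "upper s = (LINT t:{cutoff..}|lborel. of_real t powr (s - 1) * of_real (kernel t))"

lemma continuous_on_kernel: "continuous_on {0<..} kernel"
  unfolding kernel_def using w_pos by (intro continuous_intros) force

text \<open>Differentiation under the integral sign over a compact interval that stays away from
  \<open>0\<close>, where the integrand is smooth in \<open>s\<close>.\<close>

lemma upper_segment_holomorphic:
  "(\<lambda>s. LINT t:{cutoff..cutoff + real n}|lborel. of_real t powr (s - 1) * complex_of_real (kernel t)) holomorphic_on UNIV"
proof -
  let ?f = "\<lambda>s t. complex_of_real t powr (s - 1) * complex_of_real (kernel t)"
  have kc: "continuous_on (cbox cutoff (cutoff + real n)) kernel"
    by (rule continuous_on_subset[OF continuous_on_kernel]) (use cutoff_pos in auto)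
  have cont: "continuous_on (cbox cutoff (cutoff + real n)) (?f s)" for s
    using cutoff_pos by (intro continuous_intros kc) (auto simp: complex_nonpos_Reals_iff)
  have "(\<lambda>s. integral (cbox cutoff (cutoff + real n)) (?f s)) holomorphic_on UNIV"
  proof (rule leibniz_rule_holomorphic)
    show "((\<lambda>s. ?f s t) has_field_derivative Ln (of_real t) * ?f s t) (at s within UNIV)"
      if "t \<in> cbox cutoff (cutoff + real n)" for s t
    proof -
      have "complex_of_real t \<noteq> 0" using that cutoff_pos by auto
      hence "((\<lambda>u. complex_of_real t powr u) has_field_derivative Ln (of_real t) * of_real t powr (s - 1)) (at (s - 1))"
        by (rule has_field_derivative_powr_right)
      moreover have "((\<lambda>s. s - 1) has_field_derivative (1 :: complex)) (at s)"
        by (auto intro!: derivative_eq_intros)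
      ultimately
      have "((\<lambda>s. complex_of_real t powr (s - 1)) has_field_derivative Ln (of_real t) * of_real t powr (s - 1)) (at s)"
        using DERIV_chain2[of "\<lambda>u. complex_of_real t powr u"] by fastforce
      from DERIV_cmult_right[OF this, of "of_real (kernel t)"] show ?thesis
        by (simp add: mult.assoc)
    qed
    show "?f s integrable_on cbox cutoff (cutoff + real n)" for s
      by (rule integrable_continuous[OF cont])
    have "continuous_on (UNIV \<times> cbox cutoff (cutoff + real n)) (\<lambda>p. Ln (of_real (snd p)) * ?f (fst p) (snd p) :: complex)"
      using cutoff_pos
      by (intro continuous_intros continuous_on_compose2[OF kc]) (auto simp: complex_nonpos_Reals_iff)
    thus "continuous_on (UNIV \<times> cbox cutoff (cutoff + real n)) (\<lambda>(s, t). Ln (of_real t) * ?f s t)"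
      by (simp add: case_prod_unfold)
  qed auto
  moreover have "(LINT t:{cutoff..cutoff + real n}|lborel. ?f s t) = integral (cbox cutoff (cutoff + real n)) (?f s)" for s
    using set_borel_integral_eq_integral(2)[OF borel_integrable_atLeastAtMost'[OF cont[unfolded box_real]]] by simp
  ultimately show ?thesis by simp
qed

text \<open>The integrals over finite segments are entire and converge uniformly on unit
  discs.\<close>

lemma upper_holomorphic: "upper holomorphic_on UNIV"
proof -
  define f where "f = (\<lambda>s t. complex_of_real t powr (s - 1) * complex_of_real (kernel t))"
  define g where "g = (\<lambda>n s. LINT t:{cutoff..cutoff + real n}|lborel. f s t)"
  have int: "set_integrable lborel {cutoff..} (f s)" for s
    unfolding f_def by (rule kernel_cpowr_integrable_atLeast[OF cutoff_pos])
  show ?thesis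
  proof (rule holomorphic_uniform_sequence[where f = g])
    show "g n holomorphic_on UNIV" for n
      unfolding g_def f_def by (rule upper_segment_holomorphic)
    fix s0 :: complex
    \<comment> \<open>One majorant for the whole unit disc: the right edge dominates for
      \<open>t >= 1\<close>, the left edge for \<open>t < 1\<close>.\<close>
    define h where "h = (\<lambda>t. norm (f (of_real (Re s0 + 1)) t) + norm (f (of_real (Re s0 - 1)) t))"
    have hint: "set_integrable lborel {cutoff..} h"
      unfolding h_def by (intro set_integral_add set_integrable_norm int)
    have bound: "norm (f s t) \<le> h t" if s: "s \<in> cball s0 1" and t: "t > 0" for s t
    proof -
      have "\<bar>Re s0 - Re s\<bar> \<le> 1"
        using s abs_Re_le_cmod[of "s0 - s"] by (simp add: dist_norm)
      have "t powr (Re s - 1) \<le> t powr Re s0 + t powr (Re s0 - 2)"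
      proof (cases "t \<ge> 1")
        case True
        hence "t powr (Re s - 1) \<le> t powr Re s0"
          using \<open>\<bar>Re s0 - Re s\<bar> \<le> 1\<close> by (intro powr_mono) auto
        thus ?thesis by (smt (verit) powr_ge_zero)
      next
        case False
        hence "t powr (Re s - 1) \<le> t powr (Re s0 - 2)"
          using \<open>\<bar>Re s0 - Re s\<bar> \<le> 1\<close> t by (intro powr_mono') auto
        thus ?thesis by (smt (verit) powr_ge_zero)
      qed
      hence "t powr (Re s - 1) * kernel t \<le> (t powr Re s0 + t powr (Re s0 - 2)) * kernel t"
        using kernel_pos[OF t] by (intro mult_right_mono) auto
      thus ?thesis
        using t kernel_pos[OF t] by (simp add: f_def h_def norm_mult norm_powr_real_powr distrib_right)
    qed
    have un: "(\<Union>n. {cutoff..cutoff + real n}) = {cutoff..}"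
    proof (intro equalityI subsetI)
      fix t assume "t \<in> {cutoff..}"
      moreover obtain n where "t - cutoff \<le> real n" using real_arch_simple by blast
      ultimately show "t \<in> (\<Union>n. {cutoff..cutoff + real n})"
        by (auto intro!: exI[of _ n])
    qed auto
    have lim: "(\<lambda>n. LINT t:{cutoff..cutoff + real n}|lborel. h t) \<longlonglongrightarrow> (LINT t:{cutoff..}|lborel. h t)"
      using set_integral_cont_up[of "\<lambda>n. {cutoff..cutoff + real n}" lborel h] hint
      by (simp add: un incseq_def)
    have split: "(LINT t:{cutoff..}|lborel. F t) - (LINT t:{cutoff..cutoff + real n}|lborel. F t) =
        (LINT t:{cutoff + real n<..}|lborel. F t)" if F: "set_integrable lborel {cutoff..} F"
      for F :: "real \<Rightarrow> 'b :: {banach, second_countable_topology}" and n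
    proof -
      have "{cutoff..} = {cutoff..cutoff + real n} \<union> {cutoff + real n<..}" by auto
      moreover have "(LINT t:{cutoff..cutoff + real n} \<union> {cutoff + real n<..}|lborel. F t) =
          (LINT t:{cutoff..cutoff + real n}|lborel. F t) + (LINT t:{cutoff + real n<..}|lborel. F t)"
        by (rule set_integral_Un) (auto intro: set_integrable_subset[OF F])
      ultimately show ?thesis by simp
    qed
    have "uniform_limit (cball s0 1) g upper sequentially"
    proof (rule uniform_limitI)
      fix e :: real assume "e > 0"
      from lim this have "eventually (\<lambda>n. dist (LINT t:{cutoff..cutoff + real n}|lborel. h t) (LINT t:{cutoff..}|lborel. h t) < e) sequentially"
        by (rule tendstoD)
      thus "\<forall>\<^sub>F n in sequentially. \<forall>s\<in>cball s0 1. dist (g n s) (upper s) < e"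
      proof eventually_elim
        case (elim n)
        show ?case
        proof
          fix s assume s: "s \<in> cball s0 1"
          have hn: "set_integrable lborel {cutoff + real n<..} h"
            by (rule set_integrable_subset[OF hint]) auto
          have fn: "set_integrable lborel {cutoff + real n<..} (f s)"
            by (rule set_integrable_subset[OF int]) auto
          have "dist (g n s) (upper s) = norm (LINT t:{cutoff + real n<..}|lborel. f s t)"
            unfolding split[OF int, symmetric]
            by (simp add: g_def upper_def f_def dist_norm norm_minus_commute)
          also have "\<dots> \<le> (LINT t:{cutoff + real n<..}|lborel. norm (f s t))"
            by (rule set_integral_norm_bound[OF fn])
          also have "\<dots> \<le> (LINT t:{cutoff + real n<..}|lborel. h t)"
            by (rule set_integral_mono[OF set_integrable_norm[OF fn] hn])
               (use cutoff_pos in \<open>auto intro!: bound[OF s]\<close>)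
          \<comment> \<open>The error is bounded by the tail of the integral of \<open>h\<close>,
            which does not depend on \<open>s\<close>; hence uniformity.\<close>
          also have "\<dots> \<le> dist (LINT t:{cutoff..cutoff + real n}|lborel. h t) (LINT t:{cutoff..}|lborel. h t)"
            unfolding split[OF hint, symmetric] by (simp add: dist_real_def)
          finally show "dist (g n s) (upper s) < e" using elim by simp
        qed
      qed
    qed
    thus "\<exists>d>0. cball s0 d \<subseteq> UNIV \<and> uniform_limit (cball s0 d) g upper sequentially"
      by (intro exI[of _ 1]) auto
  qed auto
qed

text \<open>The only possible pole is at \<open>r - n\<close>, where HOL division makes the value
  \<open>0\<close>; the series of all terms therefore makes sense at every \<open>s\<close>.\<close>

definition pole_term :: "nat \<Rightarrow> complex \<Rightarrow> complex" where
  "pole_term n s = of_real (bern n * cutoff ^ n) / (s + of_nat n - of_nat r)"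

definition pole_tail :: "nat \<Rightarrow> complex \<Rightarrow> complex" where
  "pole_tail K s = (\<Sum>n. pole_term (n + K) s)"

text \<open>The continuation of \<open>Gamma\<close> times the Barnes series, which
  \<open>mellin_eq\<close> identifies for \<open>Re s > r\<close>.\<close>

definition mellin :: "complex \<Rightarrow> complex" where
  "mellin s = upper s + of_real cutoff powr (s - of_nat r) * (\<Sum>n. pole_term n s)"

lemma pole_tail_holomorphic: "pole_tail K holomorphic_on {s. Re s > real r - real K}"
proof -
  have "summable (\<lambda>n. norm (complex_of_real (bern (n + K) * cutoff ^ (n + K))))"
    using summable_ignore_initial_segment[OF summable_bern[of cutoff], of K] cutoff_pos
    by (simp add: abs_mult norm_mult norm_power)
  from holomorphic_on_suminf_poles[OF this, of "of_nat r - of_nat K"]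
  show ?thesis by (simp add: pole_tail_def[abs_def] pole_term_def algebra_simps)
qed

text \<open>From some index on the denominators have real part at least \<open>1\<close>, so the
  series of the absolute coefficients dominates.\<close>

lemma pole_term_summable: "summable (\<lambda>n. pole_term n s)"
proof -
  obtain K :: nat where K: "real K > real r + 1 - Re s"
    using reals_Archimedean2 by blast
  show ?thesis
  proof (rule summable_comparison_test'[where N = K])
    show "summable (\<lambda>n. \<bar>bern n\<bar> * cutoff ^ n)"
      using cutoff_pos by (intro summable_bern) auto
    fix n assume "n \<ge> K"
    hence "1 \<le> Re (s + of_nat n - of_nat r)" using K by simp
    also have "\<dots> \<le> norm (s + of_nat n - of_nat r)" by (rule complex_Re_le_cmod)
    finally have "\<bar>bern n * cutoff ^ n\<bar> / norm (s + of_nat n - of_nat r) \<le> \<bar>bern n * cutoff ^ n\<bar> / 1"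
      by (intro divide_left_mono) auto
    thus "norm (pole_term n s) \<le> \<bar>bern n\<bar> * cutoff ^ n"
      using cutoff_pos by (simp only: pole_term_def norm_divide norm_of_real abs_mult) simp
  qed
qed

lemma mellin_split:
  "mellin s = upper s + of_real cutoff powr (s - of_nat r) * ((\<Sum>n<K. pole_term n s) + pole_tail K s)"
  unfolding mellin_def pole_tail_def
  using suminf_split_initial_segment[OF pole_term_summable, of s K] by (simp add: add_ac)

lemma mellin_eq:
  assumes s: "Re s > real r"
  shows "mellin s = Gamma s * barnes_series r w a s"
proof -
  let ?f = "\<lambda>t. complex_of_real t powr (s - 1) * of_real (kernel t)"
  have "{0<..} = {0<..<cutoff} \<union> {cutoff..}" using cutoff_pos by auto
  moreover have "(LINT t:{0<..<cutoff} \<union> {cutoff..}|lborel. ?f t) =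
      (LINT t:{0<..<cutoff}|lborel. ?f t) + (LINT t:{cutoff..}|lborel. ?f t)"
    by (rule set_integral_Un)
       (use cutoff_pos in \<open>auto intro!: set_integrable_subset[OF kernel_cpowr_integrable[OF s]]\<close>)
  ultimately show ?thesis
    unfolding Gamma_barnes_series[OF s] kernel_mellin_near_0[OF s]
    using kernel_mellin_near_0[OF s] by (simp add: mellin_def upper_def pole_term_def)
qed

text \<open>The poles \<open>r - n\<close> with \<open>n >= K\<close> lie outside the half-plane,
  and the last hypothesis keeps the first \<open>K\<close> out of \<open>U\<close>.\<close>

lemma mellin_holomorphic:
  assumes "open U" "\<And>s. s \<in> U \<Longrightarrow> Re s > real r - real K"
    "\<And>s n. s \<in> U \<Longrightarrow> n < K \<Longrightarrow> s + of_nat n - of_nat r \<noteq> 0"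
  shows "mellin holomorphic_on U"
proof -
  have "(\<lambda>s. upper s + of_real cutoff powr (s - of_nat r) * ((\<Sum>n<K. pole_term n s) + pole_tail K s)) holomorphic_on U"
    unfolding pole_term_def
    by (intro holomorphic_intros holomorphic_on_subset[OF upper_holomorphic]
          holomorphic_on_subset[OF pole_tail_holomorphic[of K]]) (use assms cutoff_pos in auto)
  thus ?thesis by (simp add: mellin_split[symmetric])
qed

text \<open>Every point lies in a half-plane \<open>Re s > r - K\<close>, in which all but finitely
  many pole terms combine to a holomorphic tail.\<close>

lemma mellin_meromorphic: "mellin meromorphic_on UNIV"
proof -
  have "mellin meromorphic_on {s0}" for s0
  proof -
    obtain K :: nat where K: "real K > real r - Re s0"
      using reals_Archimedean2 by blast
    let ?U = "{s. Re s > real r - real K}"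
    have "pole_tail K analytic_on ?U"
      using pole_tail_holomorphic[of K] by (simp add: analytic_on_open open_halfspace_Re_gt)
    moreover have "upper analytic_on ?U"
      using upper_holomorphic by (metis analytic_on_open analytic_on_subset open_UNIV subset_UNIV)
    ultimately have "(\<lambda>s. upper s + of_real cutoff powr (s - of_nat r) * ((\<Sum>n<K. pole_term n s) + pole_tail K s)) meromorphic_on ?U"
      unfolding pole_term_def
      by (intro meromorphic_intros analytic_on_imp_meromorphic_on[of "\<lambda>s. of_real cutoff powr (s - of_nat r)"]
           analytic_on_imp_meromorphic_on[of "pole_tail K"] analytic_on_imp_meromorphic_on[of upper] analytic_intros)
         (use cutoff_pos in auto)
    hence "mellin meromorphic_on ?U" by (simp add: mellin_split[symmetric])
    thus ?thesis using K by (rule_tac meromorphic_on_subset) auto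
  qed
  thus ?thesis using meromorphic_on_meromorphic_at by blast
qed

text \<open>Multiplying by the entire function \<open>rGamma\<close> undoes the factor
  \<open>Gamma\<close>; \<open>remove_sings\<close> then supplies the values that a nicely
  meromorphic function must take.\<close>

lemma barnes_zeta_eq: "barnes_zeta r w a = remove_sings (\<lambda>s. rGamma s * mellin s)"
proof -
  let ?Z = "remove_sings (\<lambda>s. rGamma s * mellin s)"
  have nice: "?Z nicely_meromorphic_on UNIV"
    by (intro remove_sings_nicely_meromorphic meromorphic_intros mellin_meromorphic
          analytic_on_imp_meromorphic_on[of rGamma] analytic_intros)
  have eq: "?Z s = barnes_series r w a s" if s: "Re s > real r" for s
  proof -
    have "mellin holomorphic_on {s. Re s > real r}"
      by (rule mellin_holomorphic[where K = 0]) (auto simp: open_halfspace_Re_gt)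
    hence "mellin analytic_on {s}"
      using s analytic_on_open[OF open_halfspace_Re_gt] analytic_on_subset by blast
    hence "(\<lambda>s. rGamma s * mellin s) analytic_on {s}"
      by (intro analytic_intros)
    hence "?Z s = rGamma s * (Gamma s * barnes_series r w a s)"
      using mellin_eq[OF s] by simp
    moreover have "rGamma s \<noteq> 0"
      using s by (auto simp: rGamma_eq_zero_iff elim!: nonpos_Ints_cases)
    ultimately show ?thesis by (simp add: Gamma_def)
  qed
  show ?thesis
    unfolding barnes_zeta_def
  proof (rule the_equality)
    show "?Z nicely_meromorphic_on UNIV \<and> (\<forall>s. Re s > real r \<longrightarrow> ?Z s = barnes_series r w a s)"
      using nice eq by blast
    fix f assume f: "f nicely_meromorphic_on UNIV \<and> (\<forall>s. Re s > real r \<longrightarrow> f s = barnes_series r w a s)"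
    show "f = ?Z"
      by (rule nicely_meromorphic_on_UNIV_unique[where U = "{s. Re s > real r}" and x = "of_nat (Suc r)"])
         (use f nice eq in \<open>auto simp: open_halfspace_Re_gt\<close>)
  qed
qed

text \<open>The intermediate value theorem only yields a zero of a real part; reality turns it into
  a zero of \<open>mellin\<close> itself.\<close>

lemma mellin_real: "mellin (of_real x) \<in> \<real>"
proof -
  have "upper (of_real x) = (LINT t:{cutoff..}|lborel. of_real (t powr (x - 1) * kernel t))"
    unfolding upper_def using cutoff_pos
    by (intro set_lebesgue_integral_cong) (auto simp: powr_of_real[symmetric])
  also have "\<dots> = of_real (LINT t:{cutoff..}|lborel. t powr (x - 1) * kernel t)"
    by (rule set_integral_complex_of_real)
  finally have "upper (of_real x) \<in> \<real>" by simp
  moreover have "complex_of_real cutoff powr (of_real x - of_nat r) = of_real (cutoff powr (x - real r))"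
    using cutoff_pos by (simp add: powr_of_real[symmetric])
  moreover have "(\<Sum>n. pole_term n (of_real x)) \<in> \<real>"
  proof -
    have "pole_term n (of_real x) = of_real (bern n * cutoff ^ n / (x + real n - real r))" for n
      by (simp add: pole_term_def)
    moreover from this have "summable (\<lambda>n. bern n * cutoff ^ n / (x + real n - real r))"
      using pole_term_summable[of "of_real x"] by (simp only: summable_of_real_iff)
    ultimately show ?thesis by (simp add: suminf_of_real[symmetric] del: of_real_mult of_real_divide)
  qed
  ultimately show ?thesis by (simp add: mellin_def)
qed

subsection \<open>Zeros between consecutive integers\<close>

lemma barnes_zeta_zero:
  assumes pos: "bern (Suc k) * bern k > 0"
  shows "\<exists>\<sigma>. real r - real k - 1 < \<sigma> \<and> \<sigma> < real r - real k \<and> barnes_zeta r w a (of_real \<sigma>) = 0"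
proof -
  define p where "p = real r - real k"
  \<comment> \<open>A strip around the closed interval from \<open>p - 1\<close> to
    \<open>p\<close>, bounded by the neighbouring candidate poles; of the points
    \<open>r - n\<close> only \<open>p\<close> and \<open>p - 1\<close> lie in it.\<close>
  define V where "V = {s. Re s > p - 2} \<inter> {s. Re s < p + 1}"
  have V: "open V"
    unfolding V_def by (intro open_Int open_halfspace_Re_gt open_halfspace_Re_lt)
  have nz: "s + of_nat n - of_nat r \<noteq> 0" if "s \<in> V" "n < k" for s n
  proof -
    have "Re (s + of_nat n - of_nat r) < real n - real k + 1"
      using that(1) by (simp add: V_def p_def)
    thus ?thesis using that(2) by force
  qed
  \<comment> \<open>\<open>(s - p) (s - p + 1) * mellin s\<close> with the two poles at the ends of the interval cancelled.\<close>
  define E where "E = (\<lambda>s. (s - of_real p) * (s - of_real p + 1) * (upper s + of_real cutoff powr (s - of_nat r) *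
       ((\<Sum>n<k. pole_term n s) + pole_tail (Suc (Suc k)) s)) +
       of_real cutoff powr (s - of_nat r) * ((s - of_real p + 1) * of_real (bern k * cutoff ^ k) +
         (s - of_real p) * of_real (bern (Suc k) * cutoff ^ Suc k)))"
  have E_holo: "E holomorphic_on V"
    unfolding E_def pole_term_def
    by (intro holomorphic_intros holomorphic_on_subset[OF upper_holomorphic]
          holomorphic_on_subset[OF pole_tail_holomorphic[of "Suc (Suc k)"]])
       (use nz cutoff_pos in \<open>auto simp: V_def p_def\<close>)
  have E_eq: "E s = (s - of_real p) * (s - of_real p + 1) * mellin s"
    if s: "s - of_real p \<noteq> 0" "s - of_real p + 1 \<noteq> 0" for s
  proof -
    have "pole_term k s = of_real (bern k * cutoff ^ k) / (s - of_real p)"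
      "pole_term (Suc k) s = of_real (bern (Suc k) * cutoff ^ Suc k) / (s - of_real p + 1)"
      by (simp_all add: pole_term_def p_def algebra_simps)
    hence "(s - of_real p) * pole_term k s = of_real (bern k * cutoff ^ k)"
      "(s - of_real p + 1) * pole_term (Suc k) s = of_real (bern (Suc k) * cutoff ^ Suc k)"
      using s by simp_all
    hence "E s = (s - of_real p) * (s - of_real p + 1) * (upper s + of_real cutoff powr (s - of_nat r) *
       ((\<Sum>n<k. pole_term n s) + pole_tail (Suc (Suc k)) s)) +
       of_real cutoff powr (s - of_nat r) * ((s - of_real p + 1) * ((s - of_real p) * pole_term k s) +
         (s - of_real p) * ((s - of_real p + 1) * pole_term (Suc k) s))"
      by (simp only: E_def)
    also have "\<dots> = (s - of_real p) * (s - of_real p + 1) * mellin s"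
      by (simp add: mellin_split[of s "Suc (Suc k)"]) algebra
    finally show ?thesis .
  qed
  define h where "h = (\<lambda>x. Re (E (of_real x)))"
  have cont: "continuous_on {p - 1..p} h"
    unfolding h_def
    by (intro continuous_intros continuous_on_compose2[OF holomorphic_on_imp_continuous_on[OF E_holo]])
       (auto simp: V_def)
  have powr_eq: "complex_of_real cutoff powr (of_real x - of_nat r) = of_real (cutoff powr (x - real r))" for x
    using cutoff_pos by (simp add: powr_of_real[symmetric])
  \<comment> \<open>At each endpoint only the residue of that endpoint survives. The factor
    \<open>s - p\<close> is \<open>-1\<close> at the left end, so equal signs of the two
    coefficients give opposite signs of \<open>h\<close>.\<close>
  have h_right: "h p = cutoff powr (p - real r) * cutoff ^ k * bern k"
    by (simp add: h_def E_def powr_eq)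
  have h_left: "h (p - 1) = - (cutoff powr (p - 1 - real r) * cutoff ^ Suc k * bern (Suc k))"
    using powr_eq[of "p - 1"] by (simp add: h_def E_def)
  have "\<exists>x. p - 1 \<le> x \<and> x \<le> p \<and> h x = 0"
  proof (cases "bern k > 0")
    case True
    hence "bern (Suc k) > 0" using pos by (simp add: zero_less_mult_iff)
    thus ?thesis using True cutoff_pos
      by (intro IVT' cont) (auto simp: h_left h_right)
  next
    case False
    hence "bern (Suc k) < 0" "bern k < 0" using pos by (auto simp: zero_less_mult_iff)
    thus ?thesis using cutoff_pos
      by (intro IVT2' cont) (auto simp: h_left h_right mult_le_0_iff)
  qed
  then obtain x where x: "p - 1 \<le> x" "x \<le> p" "h x = 0" by blast
  \<comment> \<open>Nonzero residues keep the zero off the endpoints, so the factors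
    \<open>x - p\<close> and \<open>x - p + 1\<close> can be divided out.\<close>
  have "h p \<noteq> 0" "h (p - 1) \<noteq> 0"
    using pos cutoff_pos by (auto simp: h_left h_right)
  hence x': "p - 1 < x" "x < p"
    using x by (metis less_eq_real_def)+
  have ne: "complex_of_real x - of_real p \<noteq> 0" "complex_of_real x - of_real p + 1 \<noteq> 0"
    using x' by (auto simp: complex_eq_iff)
  obtain y where y: "mellin (of_real x) = of_real y"
    using mellin_real by (auto elim: Reals_cases)
  have "E (of_real x) = of_real ((x - p) * (x - p + 1) * y)"
    using E_eq[OF ne] y by simp
  hence "y = 0" using x(3) x' by (simp add: h_def)
  hence mz: "mellin (of_real x) = 0" using y by simp
  \<comment> \<open>The open strip between consecutive candidate poles: \<open>mellin\<close> is
    analytic at \<open>x\<close>, so \<open>remove_sings\<close> leaves the value there unchanged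
    and the zero passes to \<open>barnes_zeta\<close>.\<close>
  define W where "W = {s. Re s > p - 1} \<inter> {s. Re s < p}"
  have "mellin holomorphic_on W"
  proof (rule mellin_holomorphic[where K = "Suc k"])
    show "open W"
      unfolding W_def by (intro open_Int open_halfspace_Re_gt open_halfspace_Re_lt)
    show "s + of_nat n - of_nat r \<noteq> 0" if "s \<in> W" "n < Suc k" for s n
    proof -
      have "Re (s + of_nat n - of_nat r) < real n - real k"
        using that(1) by (simp add: W_def p_def)
      thus ?thesis using that(2) by force
    qed
  qed (auto simp: W_def p_def)
  moreover have "open W"
    unfolding W_def by (intro open_Int open_halfspace_Re_gt open_halfspace_Re_lt)
  moreover have "of_real x \<in> W" using x' by (simp add: W_def)
  ultimately have "mellin analytic_on {of_real x}"
    using analytic_on_open analytic_on_subset by blast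
  hence "(\<lambda>s. rGamma s * mellin s) analytic_on {of_real x}"
    by (intro analytic_intros)
  hence "barnes_zeta r w a (of_real x) = 0"
    by (simp add: barnes_zeta_eq mz)
  thus ?thesis using x' by (auto simp: p_def)
qed

end

theorem theorem3p4:
  fixes r :: nat and a :: real and w :: "nat \<Rightarrow> real" and N :: int
  assumes "r \<ge> 1"
    and "a > 0"
    and "\<And>i. i \<in> {1..r} \<Longrightarrow> w i > 0"
    and "N \<ge> - int r"
    and "barnes_bernoulli r (nat (int r + N + 1)) a w *
         barnes_bernoulli r (nat (int r + N)) a w > 0"
  shows "\<exists>\<sigma>::real. \<sigma> \<in> {real_of_int (- N - 1)<..<real_of_int (- N)} \<and>
           barnes_zeta r w a (of_real \<sigma>) = 0"
proof -
  interpret barnes_weights r w a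
    by standard (use assms in auto)
  define k where "k = nat (int r + N)"
  \<comment> \<open>As \<open>N >= - r\<close>, the conversions by \<open>nat\<close> are exact; the
    interval from \<open>r - k - 1\<close> to \<open>r - k\<close> is then the one from
    \<open>- N - 1\<close> to \<open>- N\<close>.\<close>
  have k: "nat (int r + N + 1) = Suc k" "N = int k - int r"
    using assms(4) by (auto simp: k_def)
  have "bern (Suc k) * bern k =
      barnes_bernoulli r (Suc k) a w * barnes_bernoulli r k a w / (fact (Suc k) * fact k)"
    by (simp add: bern_def)
  hence "bern (Suc k) * bern k > 0"
    using assms(5) by (simp add: k(1) flip: k_def)
  from barnes_zeta_zero[OF this] show ?thesis
    by (auto simp: k(2))
qed

end
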